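(* Let $\gamma:I\to M\subset G^3$ be a unit speed curve on a surface $M$ in the Galilean space $G^3$, with geodesic curvature $\kappa_g$, normal curvature $\kappa_n$ and geodesic torsion $\tau_g$. Then the $\mathbf{TN}$, $\mathbf{TB}$ and $\mathbf{TNB}$ special Smarandache curves of $\gamma$ with respect to its Frenet frame are, respectively, $$\gamma_{\mathbf{TN}}=\left(1,\ \int N_1\,dx+\frac{1}{\sqrt{\kappa_g^2+\kappa_n^2}}N_1,\ \int N_2\,dx+\frac{1}{\sqrt{\kappa_g^2+\kappa_n^2}}N_2\right),$$ $$\gamma_{\mathbf{TB}}=\left(1,\ \int N_1\,dx-\frac{1}{\sqrt{\kappa_g^2+\kappa_n^2}}N_2,\ \int N_2\,dx+\frac{1}{\sqrt{\kappa_g^2+\kappa_n^2}}N_1\right),$$ $$\gamma_{\mathbf{TNB}}=\left(1,\ \int N_1\,dx+\frac{1}{\sqrt{\kappa_g^2+\kappa_n^2}}(N_1-N_2),\ \int N_2\,dx+\frac{1}{\sqrt{\kappa_g^2+\kappa_n^2}}(N_1+N_2)\right),$$ where $$N_1=\kappa_g\sin\Big(\int\tau_g\,dx\Big)+\kappa_n\cos\Big(\int\tau_g\,dx\Big),\qquad N_2=\kappa_g\cos\Big(\int\tau_g\,dx\Big)-\kappa_n\sin\Big(\int\tau_g\,dx\Big).$$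
   Context: Galilean space $G^3$ is $\mathbb{R}^3$ with scalar product $v\cdot_G w=v_1w_1$ if $v_1\ne0$ or $w_1\neq 0$, and $v\cdot_G w=v_2w_2+v_3w_3$ if $v_1=w_1=0$; norm $\|v\|_G=\sqrt{|v\cdot_G v|}$; cross product $v\times_G w=(0,\ v_3w_1-v_1w_3,\ v_1w_2-v_2w_1)$. A vector is isotropic if its first component is $0$. A unit speed curve is written $\gamma(x)=(x,y(x),z(x))$, $x\in I\subset\mathbb{R}$; its curvature is $\kappa=\|\gamma''\|_G$ (assumed $>0$) and its Frenet frame is $\mathbf T=\gamma'$, $\mathbf N=\gamma''/\kappa$, $\mathbf B=\mathbf T\times_G\mathbf N=\frac1\kappa(0,-z'',y'')$. For a curve $\gamma$ on a surface $M$, $\mathbf n$ is the unit normal vector field of $M$ along $\gamma$ (the isotropic unit vector field in the direction of $\phi_u\times_G\phi_v$ for a local parametrization $\phi(u,v)$ of $M$), and $\mathbf Q=\mathbf n\times_G\mathbf T$. The geodesic curvature $\kappa_g$, normal curvature $\kappa_n$ and geodesic torsion $\tau_g$ are the functions of $x$ in the Darboux formulas $\mathbf T'=\kappa_g\mathbf Q+\kappa_n\mathbf n$, $\mathbf Q'=\tau_g\mathbf n$, $\mathbf n'=-\tau_g\mathbf Q$. One has $\kappa^2=\kappa_g^2+\kappa_n^2$. Special Smarandache curves of $\gamma$: $\gamma_{\mathbf{TN}}=\mathbf T+\mathbf N$, $\gamma_{\mathbf{TB}}=\mathbf T+\mathbf B$, $\gamma_{\mathbf{TNB}}=\mathbf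 T+\mathbf N+\mathbf B$. Integral signs denote indefinite integrals.
   Formalization: The formulas fail if the integral of τ_g has the same constant of integration in N_1 and N_2 (the sign of N_2 is off); here the two integrals of τ_g may have different constants, and suitable antiderivatives are asserted to exist. *)

theory Defs
  imports "HOL-Analysis.Analysis"
begin

section \<open>Galilean space\<close>

definition gal_inner :: "real^3 \<Rightarrow> real^3 \<Rightarrow> real" where
  "gal_inner v w =
     (if v $ 1 \<noteq> 0 \<or> w $ 1 \<noteq> 0 then v $ 1 * w $ 1 else v $ 2 * w $ 2 + v $ 3 * w $ 3)"

definition gal_norm :: "real^3 \<Rightarrow> real" where
  "gal_norm v = sqrt \<bar>gal_inner v v\<bar>"

definition gal_cross :: "real^3 \<Rightarrow> real^3 \<Rightarrow> real^3" where
  "gal_cross v w = vector [0, v $ 3 * w $ 1 - v $ 1 * w $ 3, v $ 1 * w $ 2 - v $ 2 * w $ 1]"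

section \<open>Unit speed curves and their Frenet frame\<close>

text \<open>
  Derivatives are taken within the parameter interval \<open>I\<close>, so that \<open>I\<close> may contain its
  endpoints; in the interior they are the ordinary derivatives.
\<close>

definition tangent :: "real set \<Rightarrow> (real \<Rightarrow> real^3) \<Rightarrow> real \<Rightarrow> real^3" where
  "tangent I \<gamma> x = vector_derivative \<gamma> (at x within I)"

definition acceleration :: "real set \<Rightarrow> (real \<Rightarrow> real^3) \<Rightarrow> real \<Rightarrow> real^3" where
  "acceleration I \<gamma> x = vector_derivative (tangent I \<gamma>) (at x within I)"

definition curvature :: "real set \<Rightarrow> (real \<Rightarrow> real^3) \<Rightarrow> real \<Rightarrow> real" where
  "curvature I \<gamma> x = gal_norm (acceleration I \<gamma> x)"

definition principal_normal :: "real set \<Rightarrow> (real \<Rightarrow> real^3) \<Rightarrow> real \<Rightarrow> real^3" where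
  "principal_normal I \<gamma> x = (1 / curvature I \<gamma> x) *\<^sub>R acceleration I \<gamma> x"

definition binormal :: "real set \<Rightarrow> (real \<Rightarrow> real^3) \<Rightarrow> real \<Rightarrow> real^3" where
  "binormal I \<gamma> x = gal_cross (tangent I \<gamma> x) (principal_normal I \<gamma> x)"

definition unit_speed_curve :: "real set \<Rightarrow> (real \<Rightarrow> real^3) \<Rightarrow> bool" where
  "unit_speed_curve I \<gamma> \<longleftrightarrow>
     \<gamma> differentiable_on I \<and> tangent I \<gamma> differentiable_on I \<and>
     (\<forall>x\<in>I. \<gamma> x $ 1 = x) \<and> (\<forall>x\<in>I. curvature I \<gamma> x > 0)"

definition smarandache_TN :: "real set \<Rightarrow> (real \<Rightarrow> real^3) \<Rightarrow> real \<Rightarrow> real^3" where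
  "smarandache_TN I \<gamma> x = tangent I \<gamma> x + principal_normal I \<gamma> x"

definition smarandache_TB :: "real set \<Rightarrow> (real \<Rightarrow> real^3) \<Rightarrow> real \<Rightarrow> real^3" where
  "smarandache_TB I \<gamma> x = tangent I \<gamma> x + binormal I \<gamma> x"

definition smarandache_TNB :: "real set \<Rightarrow> (real \<Rightarrow> real^3) \<Rightarrow> real \<Rightarrow> real^3" where
  "smarandache_TNB I \<gamma> x = tangent I \<gamma> x + principal_normal I \<gamma> x + binormal I \<gamma> x"

section \<open>Surfaces and the Darboux frame of a curve on a surface\<close>

definition partial_u :: "(real \<times> real \<Rightarrow> real^3) \<Rightarrow> real \<times> real \<Rightarrow> real^3" where
  "partial_u \<phi> p = frechet_derivative \<phi> (at p) (1, 0)"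

definition partial_v :: "(real \<times> real \<Rightarrow> real^3) \<Rightarrow> real \<times> real \<Rightarrow> real^3" where
  "partial_v \<phi> p = frechet_derivative \<phi> (at p) (0, 1)"

text \<open>
  Only continuous differentiability is required of a parametrization, so smooth surfaces are covered.
\<close>

definition local_parametrization ::
    "(real^3) set \<Rightarrow> (real \<times> real) set \<Rightarrow> (real \<times> real \<Rightarrow> real^3) \<Rightarrow> bool" where
  "local_parametrization M U \<phi> \<longleftrightarrow>
     open U \<and>
     (\<forall>p\<in>U. \<phi> differentiable (at p)) \<and>
     continuous_on U (partial_u \<phi>) \<and> continuous_on U (partial_v \<phi>) \<and>
     (\<forall>p\<in>U. inj (frechet_derivative \<phi> (at p))) \<and>
     openin (top_of_set M) (\<phi> ` U) \<and>
     (\<exists>\<psi>. homeomorphism U (\<phi> ` U) \<phi> \<psi>)"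

definition regular_surface :: "(real^3) set \<Rightarrow> bool" where
  "regular_surface M \<longleftrightarrow> (\<forall>q\<in>M. \<exists>U \<phi>. local_parametrization M U \<phi> \<and> q \<in> \<phi> ` U)"

text \<open>
  Exchanging the two parameters reverses the sign of the Galilean normal, so at a single point the
  next definition determines \<open>n x\<close> up to sign.  The differentiability of \<open>n\<close> contained in the Darboux
  formulas below makes the choice of sign consistent along the curve.
\<close>

definition unit_normal_along ::
    "(real^3) set \<Rightarrow> real set \<Rightarrow> (real \<Rightarrow> real^3) \<Rightarrow> (real \<Rightarrow> real^3) \<Rightarrow> bool" where
  "unit_normal_along M I \<gamma> n \<longleftrightarrow>
     (\<forall>x\<in>I. \<exists>U \<phi> p. local_parametrization M U \<phi> \<and> p \<in> U \<and> \<phi> p = \<gamma> x \<and>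
        (let w = gal_cross (partial_u \<phi> p) (partial_v \<phi> p)
         in w \<noteq> 0 \<and> n x = (1 / gal_norm w) *\<^sub>R w))"

definition darboux_Q ::
    "real set \<Rightarrow> (real \<Rightarrow> real^3) \<Rightarrow> (real \<Rightarrow> real^3) \<Rightarrow> real \<Rightarrow> real^3" where
  "darboux_Q I \<gamma> n x = gal_cross (n x) (tangent I \<gamma> x)"

text \<open>
  As \<open>darboux_Q I \<gamma> n x\<close> and \<open>n x\<close> form a basis of the isotropic vectors, these equations determine
  the geodesic curvature \<open>\<kappa>g\<close>, the normal curvature \<open>\<kappa>n\<close> and the geodesic torsion \<open>\<tau>g\<close> on \<open>I\<close>.
\<close>

definition darboux_formulas ::
    "real set \<Rightarrow> (real \<Rightarrow> real^3) \<Rightarrow> (real \<Rightarrow> real^3) \<Rightarrow>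
     (real \<Rightarrow> real) \<Rightarrow> (real \<Rightarrow> real) \<Rightarrow> (real \<Rightarrow> real) \<Rightarrow> bool" where
  "darboux_formulas I \<gamma> n \<kappa>g \<kappa>n \<tau>g \<longleftrightarrow>
     (\<forall>x\<in>I.
        (tangent I \<gamma> has_vector_derivative \<kappa>g x *\<^sub>R darboux_Q I \<gamma> n x + \<kappa>n x *\<^sub>R n x) (at x within I) \<and>
        (darboux_Q I \<gamma> n has_vector_derivative \<tau>g x *\<^sub>R n x) (at x within I) \<and>
        (n has_vector_derivative - \<tau>g x *\<^sub>R darboux_Q I \<gamma> n x) (at x within I))"

section \<open>Indefinite integrals\<close>

definition indefinite_integral :: "real set \<Rightarrow> (real \<Rightarrow> real) \<Rightarrow> (real \<Rightarrow> real) \<Rightarrow> bool" where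
  "indefinite_integral I f F \<longleftrightarrow> (\<forall>x\<in>I. (F has_real_derivative f x) (at x within I))"

text \<open>
  In the two functions below \<open>\<Theta>\<close> is an indefinite integral of the geodesic torsion.  Its constant of
  integration need not be the same in both.  With \<open>n = (0, cos \<theta>, sin \<theta>)\<close>, where \<open>\<theta>' = \<tau>g\<close>, one has
  \<open>Q = n \<times> T = (0, sin \<theta>, - cos \<theta>)\<close>, hence
  \<open>T' = (0, \<kappa>g sin \<theta> + \<kappa>n cos \<theta>, - (\<kappa>g cos \<theta> - \<kappa>n sin \<theta>))\<close>.
  So \<open>T' = (0, N1, N2)\<close> with \<open>\<Theta> = \<theta>\<close> in \<open>N1\<close> and \<open>\<Theta> = \<theta> + \<pi>\<close> in \<open>N2\<close>, and in general this cannot be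
  achieved with equal constants, even for constant \<open>n\<close>: \<open>(\<kappa>g, \<kappa>n) \<mapsto> (N1, N2)\<close> would then be a reflection, whereas
  \<open>(\<kappa>g, \<kappa>n) \<mapsto> T'\<close> is a rotation.
\<close>

definition N1 :: "(real \<Rightarrow> real) \<Rightarrow> (real \<Rightarrow> real) \<Rightarrow> (real \<Rightarrow> real) \<Rightarrow> real \<Rightarrow> real" where
  "N1 \<kappa>g \<kappa>n \<Theta> x = \<kappa>g x * sin (\<Theta> x) + \<kappa>n x * cos (\<Theta> x)"

definition N2 :: "(real \<Rightarrow> real) \<Rightarrow> (real \<Rightarrow> real) \<Rightarrow> (real \<Rightarrow> real) \<Rightarrow> real \<Rightarrow> real" where
  "N2 \<kappa>g \<kappa>n \<Theta> x = \<kappa>g x * cos (\<Theta> x) - \<kappa>n x * sin (\<Theta> x)"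

end

theory Submission
  imports Defs
begin

text \<open>
  The unit normal is isotropic of norm \<open>1\<close> and varies continuously along the interval, so it has a
  continuous angle, \<open>n = (0, cos \<theta>, sin \<theta>)\<close>.  As \<open>T\<close> has first component \<open>1\<close>, this gives
  \<open>Q = (0, sin \<theta>, - cos \<theta>)\<close>, and the Darboux formula for \<open>n'\<close> becomes \<open>\<theta>' = \<tau>g\<close>.  The formula for \<open>T'\<close>
  then reads \<open>T' = (0, N1, N2)\<close> with \<open>\<Theta> = \<theta>\<close> in \<open>N1\<close> and \<open>\<Theta> = \<theta> + pi\<close> in \<open>N2\<close>, so the last two
  components of \<open>T\<close> are the required indefinite integrals and \<open>\<kappa>\<^sup>2 = \<kappa>g\<^sup>2 + \<kappa>n\<^sup>2\<close>.
\<close>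

text \<open>Near \<open>x\<close>, continuity keeps the imaginary part of \<open>g y - g x\<close>
  below pi in modulus, where \<open>Ln\<close> inverts \<open>exp\<close>. So \<open>g y\<close>
  equals \<open>g x + Ln (f y / f x)\<close> there, and \<open>g\<close> inherits differentiability
  from \<open>f\<close> and from \<open>Ln\<close> at 1.\<close>

lemma continuous_logarithm_has_vector_derivative:
  fixes f g :: "real \<Rightarrow> complex"
  assumes g: "continuous_on I g" and fg: "\<And>x. x \<in> I \<Longrightarrow> f x = exp (g x)"
    and f': "(f has_vector_derivative f') (at x within I)" and x: "x \<in> I"
  shows "(g has_vector_derivative f' / f x) (at x within I)"
proof -
  have fx: "f x \<noteq> 0"
    using fg[OF x] by simp
  obtain d where d: "d > 0" "\<And>y. \<lbrakk>y \<in> I; dist y x < d\<rbrakk> \<Longrightarrow> dist (g y) (g x) < pi"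
    using g x pi_gt_zero unfolding continuous_on_iff by metis
  have local_eq: "g x + Ln (f y / f x) = g y" if "y \<in> I" "dist y x < d" for y
  proof -
    have "\<bar>Im (g y - g x)\<bar> < pi"
      using d(2)[OF that] abs_Im_le_cmod[of "g y - g x"] by (simp add: dist_norm)
    then have "Ln (exp (g y - g x)) = g y - g x"
      by (intro Ln_exp) auto
    then show ?thesis
      using that x by (simp add: fg exp_diff)
  qed
  have "((\<lambda>y. f y / f x) has_vector_derivative f' / f x) (at x within I)"
    using has_vector_derivative_mult_left[OF f', of "1 / f x"] by simp
  \<comment> \<open>The point 1 is written \<open>f x / f x\<close> to match the inner function of
    the chain rule at \<open>x\<close>.\<close>
  moreover have "(Ln has_field_derivative 1) (at (f x / f x))"
    using fx has_field_derivative_Ln[of 1] by simp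
  ultimately have "((Ln \<circ> (\<lambda>y. f y / f x)) has_vector_derivative f' / f x * 1) (at x within I)"
    by (rule field_vector_diff_chain_within[OF _ has_field_derivative_at_within])
  from has_vector_derivative_add[OF has_vector_derivative_const[of "g x"] this]
  have "((\<lambda>y. g x + Ln (f y / f x)) has_vector_derivative f' / f x) (at x within I)"
    by (simp add: o_def)
  then show ?thesis
    by (rule has_vector_derivative_transform_within[OF _ d(1) x]) (use local_eq in auto)
qed

text \<open>The function \<open>a + i b\<close> has modulus 1 and solves
  \<open>f' = i \<tau> f\<close>. An interval is contractible, so \<open>f\<close> has a continuous
  logarithm, whose derivative is \<open>f' / f = i \<tau>\<close>; its imaginary part is the angle.
  Lifting avoids integrating \<open>\<tau>\<close>, about which no regularity is assumed.\<close>

lemma ex_angle_of_rotating_unit_vector: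
  fixes a b \<tau> :: "real \<Rightarrow> real"
  assumes I: "is_interval I"
    and a: "\<And>x. x \<in> I \<Longrightarrow> (a has_real_derivative - \<tau> x * b x) (at x within I)"
    and b: "\<And>x. x \<in> I \<Longrightarrow> (b has_real_derivative \<tau> x * a x) (at x within I)"
    and unit: "\<And>x. x \<in> I \<Longrightarrow> (a x)\<^sup>2 + (b x)\<^sup>2 = 1"
  obtains \<theta> where "\<And>x. x \<in> I \<Longrightarrow> a x = cos (\<theta> x)" "\<And>x. x \<in> I \<Longrightarrow> b x = sin (\<theta> x)"
    "\<And>x. x \<in> I \<Longrightarrow> (\<theta> has_real_derivative \<tau> x) (at x within I)"
proof -
  define f where "f x = Complex (a x) (b x)" for x
  have f': "(f has_vector_derivative \<i> * \<tau> x * f x) (at x within I)" if "x \<in> I" for x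
  proof -
    have "((\<lambda>x. of_real (a x) + \<i> * of_real (b x)) has_vector_derivative
        of_real (- \<tau> x * b x) + \<i> * of_real (\<tau> x * a x)) (at x within I)"
      by (intro has_vector_derivative_add has_vector_derivative_mult_right
          has_vector_derivative_of_real a b that)
    moreover have "of_real (- \<tau> x * b x) + \<i> * of_real (\<tau> x * a x) = \<i> * \<tau> x * f x"
      by (simp add: f_def complex_eq_iff)
    ultimately show ?thesis
      by (simp add: f_def[abs_def] Complex_eq)
  qed
  have norm_f: "norm (f x) = 1" if "x \<in> I" for x
    using unit[OF that] by (simp add: f_def complex_norm)
  have "continuous_on I f"
    by (rule continuous_on_vector_derivative) (rule f')
  moreover have "contractible I"
    using I by (simp add: is_interval_contractible_1)
  moreover have "\<And>x. x \<in> I \<Longrightarrow> f x \<noteq> 0"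
    using norm_f by fastforce
  ultimately obtain g where g: "continuous_on I g" "\<And>x. x \<in> I \<Longrightarrow> f x = exp (g x)"
    using continuous_logarithm_on_contractible[of I f] by metis
  define \<theta> where "\<theta> x = Im (g x)" for x
  \<comment> \<open>Modulus 1 forces the real part of \<open>g x\<close> to be 0.\<close>
  have f_cis: "f x = cis (\<theta> x)" if "x \<in> I" for x
    using norm_f[OF that] g(2)[OF that] by (simp add: exp_eq_polar norm_mult \<theta>_def)
  have "(\<theta> has_real_derivative \<tau> x) (at x within I)" if "x \<in> I" for x
  proof -
    have "f x \<noteq> 0"
      using norm_f[OF that] by auto
    then have "(g has_vector_derivative \<i> * \<tau> x) (at x within I)"
      using continuous_logarithm_has_vector_derivative[OF g f'[OF that] that] by simp
    from bounded_linear.has_vector_derivative[OF bounded_linear_Im this] show ?thesis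
      by (simp add: \<theta>_def[abs_def] has_real_derivative_iff_has_vector_derivative)
  qed
  then show thesis
    by (intro that[of \<theta>]) (use f_cis in \<open>auto simp: f_def complex_eq_iff\<close>)
qed

lemma gal_cross_nth [simp]:
  "gal_cross v w $ 1 = 0"
  "gal_cross v w $ 2 = v $ 3 * w $ 1 - v $ 1 * w $ 3"
  "gal_cross v w $ 3 = v $ 1 * w $ 2 - v $ 2 * w $ 1"
  by (simp_all add: gal_cross_def)

lemma gal_norm_isotropic: "v $ 1 = 0 \<Longrightarrow> gal_norm v = sqrt ((v $ 2)\<^sup>2 + (v $ 3)\<^sup>2)"
  by (simp add: gal_norm_def gal_inner_def power2_eq_square)

text \<open>Galilean cross products are isotropic, and on isotropic vectors the Galilean norm is the
  Euclidean norm of the last two components, so it is nonzero on nonzero vectors and normalizing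
  works.\<close>

lemma unit_normal_along_isotropic:
  assumes "unit_normal_along M I \<gamma> n" "x \<in> I"
  shows "n x $ 1 = 0" "(n x $ 2)\<^sup>2 + (n x $ 3)\<^sup>2 = 1"
proof -
  obtain w where w: "w \<noteq> 0" "w $ 1 = 0" "n x = (1 / gal_norm w) *\<^sub>R w"
    using assms unfolding unit_normal_along_def Let_def by (metis gal_cross_nth(1))
  have "(w $ 2)\<^sup>2 + (w $ 3)\<^sup>2 \<noteq> 0"
    using w(1,2) by (auto simp: vec_eq_iff forall_3 sum_power2_eq_zero_iff)
  then show "n x $ 1 = 0" "(n x $ 2)\<^sup>2 + (n x $ 3)\<^sup>2 = 1"
    using w by (simp_all add: gal_norm_isotropic power_divide add_divide_distrib[symmetric])
qed

text \<open>Makes derivatives within \<open>I\<close> unique, also at endpoints: a connected set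
  with more than one point has no isolated points.\<close>

lemma interval_at_within_neq_bot:
  fixes I :: "real set"
  assumes "is_interval I" "interior I \<noteq> {}" "x \<in> I"
  shows "at x within I \<noteq> bot"
proof -
  have "I \<noteq> {y}" for y
    using assms(2) by auto
  then show ?thesis
    using assms connected_imp_perfect[of I x]
    by (auto simp: is_interval_connected_1 trivial_limit_within)
qed

lemma has_real_derivative_nth:
  fixes f :: "real \<Rightarrow> real ^ 'n"
  assumes "(f has_vector_derivative f') F"
  shows "((\<lambda>x. f x $ i) has_real_derivative f' $ i) F"
  using bounded_linear.has_vector_derivative[OF bounded_linear_vec_nth assms]
  by (simp add: has_real_derivative_iff_has_vector_derivative)

lemma tangent_nth_1:
  assumes "unit_speed_curve I \<gamma>" "x \<in> I" "at x within I \<noteq> bot"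
  shows "tangent I \<gamma> x $ 1 = 1"
proof -
  have "(\<gamma> has_vector_derivative tangent I \<gamma> x) (at x within I)"
    using assms unfolding unit_speed_curve_def tangent_def
    by (simp add: differentiable_on_def vector_derivative_works)
  then have "((\<lambda>x. \<gamma> x $ 1) has_real_derivative tangent I \<gamma> x $ 1) (at x within I)"
    by (rule has_real_derivative_nth)
  moreover have "((\<lambda>x. \<gamma> x $ 1) has_real_derivative 1) (at x within I)"
    \<comment> \<open>The radius 1 is arbitrary, since the first coordinate of
      \<open>\<gamma>\<close> is the identity on all of \<open>I\<close>.\<close>
    by (rule has_field_derivative_transform_within[OF DERIV_ident zero_less_one assms(2)])
      (use assms(1) in \<open>simp add: unit_speed_curve_def\<close>)
  ultimately show ?thesis
    using vector_derivative_unique_within[OF assms(3)]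
    by (simp add: has_real_derivative_iff_has_vector_derivative)
qed

text \<open>With \<open>T\<close> of first component 1 and \<open>N\<close> isotropic,
  \<open>T x N\<close> is \<open>N\<close> turned by a right angle in the isotropic plane; hence the
  swapped components and the minus sign wherever \<open>B\<close> enters.\<close>

lemma smarandache_components:
  assumes T: "tangent I \<gamma> x $ 1 = 1" and A: "acceleration I \<gamma> x $ 1 = 0"
  defines "r \<equiv> 1 / curvature I \<gamma> x"
  shows "smarandache_TN I \<gamma> x = vector [1,
        tangent I \<gamma> x $ 2 + r * acceleration I \<gamma> x $ 2,
        tangent I \<gamma> x $ 3 + r * acceleration I \<gamma> x $ 3]"
    and "smarandache_TB I \<gamma> x = vector [1,
        tangent I \<gamma> x $ 2 - r * acceleration I \<gamma> x $ 3,
        tangent I \<gamma> x $ 3 + r * acceleration I \<gamma> x $ 2]"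
    and "smarandache_TNB I \<gamma> x = vector [1,
        tangent I \<gamma> x $ 2 + r * (acceleration I \<gamma> x $ 2 - acceleration I \<gamma> x $ 3),
        tangent I \<gamma> x $ 3 + r * (acceleration I \<gamma> x $ 2 + acceleration I \<gamma> x $ 3)]"
  using T A
  by (simp_all add: vec_eq_iff forall_3 smarandache_TN_def smarandache_TB_def smarandache_TNB_def
      binormal_def principal_normal_def r_def algebra_simps)

theorem theorem3:
  fixes I :: "real set" and M :: "(real^3) set" and \<gamma> n :: "real \<Rightarrow> real^3"
    and \<kappa>g \<kappa>n \<tau>g :: "real \<Rightarrow> real"
  assumes "is_interval I" and "interior I \<noteq> {}"
    and "regular_surface M"
    and "unit_speed_curve I \<gamma>"
    and "\<gamma> ` I \<subseteq> M"
    and "unit_normal_along M I \<gamma> n"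
    and "darboux_formulas I \<gamma> n \<kappa>g \<kappa>n \<tau>g"
  shows "\<exists>\<Theta>1 \<Theta>2 S1 S2.
    indefinite_integral I \<tau>g \<Theta>1 \<and> indefinite_integral I \<tau>g \<Theta>2 \<and>
    indefinite_integral I (N1 \<kappa>g \<kappa>n \<Theta>1) S1 \<and> indefinite_integral I (N2 \<kappa>g \<kappa>n \<Theta>2) S2 \<and>
    (\<forall>x\<in>I.
      smarandache_TN I \<gamma> x = vector
        [1,
         S1 x + 1 / sqrt ((\<kappa>g x)\<^sup>2 + (\<kappa>n x)\<^sup>2) * N1 \<kappa>g \<kappa>n \<Theta>1 x,
         S2 x + 1 / sqrt ((\<kappa>g x)\<^sup>2 + (\<kappa>n x)\<^sup>2) * N2 \<kappa>g \<kappa>n \<Theta>2 x] \<and>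
      smarandache_TB I \<gamma> x = vector
        [1,
         S1 x - 1 / sqrt ((\<kappa>g x)\<^sup>2 + (\<kappa>n x)\<^sup>2) * N2 \<kappa>g \<kappa>n \<Theta>2 x,
         S2 x + 1 / sqrt ((\<kappa>g x)\<^sup>2 + (\<kappa>n x)\<^sup>2) * N1 \<kappa>g \<kappa>n \<Theta>1 x] \<and>
      smarandache_TNB I \<gamma> x = vector
        [1,
         S1 x + 1 / sqrt ((\<kappa>g x)\<^sup>2 + (\<kappa>n x)\<^sup>2) * (N1 \<kappa>g \<kappa>n \<Theta>1 x - N2 \<kappa>g \<kappa>n \<Theta>2 x),
         S2 x + 1 / sqrt ((\<kappa>g x)\<^sup>2 + (\<kappa>n x)\<^sup>2) * (N1 \<kappa>g \<kappa>n \<Theta>1 x + N2 \<kappa>g \<kappa>n \<Theta>2 x)])"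
proof -
  note normal = unit_normal_along_isotropic[OF assms(6)]
  have nontriv: "at x within I \<noteq> bot" if "x \<in> I" for x
    using interval_at_within_neq_bot[OF assms(1,2) that] .
  have T1: "tangent I \<gamma> x $ 1 = 1" if "x \<in> I" for x
    using tangent_nth_1[OF assms(4) that nontriv[OF that]] .
  have Q: "darboux_Q I \<gamma> n x $ 1 = 0" "darboux_Q I \<gamma> n x $ 2 = n x $ 3"
    "darboux_Q I \<gamma> n x $ 3 = - n x $ 2" if "x \<in> I" for x
    using that by (simp_all add: darboux_Q_def normal T1)
  have T': "(tangent I \<gamma> has_vector_derivative \<kappa>g x *\<^sub>R darboux_Q I \<gamma> n x + \<kappa>n x *\<^sub>R n x)
      (at x within I)"
    and n': "(n has_vector_derivative - \<tau>g x *\<^sub>R darboux_Q I \<gamma> n x) (at x within I)"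
    if "x \<in> I" for x
    using assms(7) that unfolding darboux_formulas_def by blast+
  have n2': "((\<lambda>x. n x $ 2) has_real_derivative - \<tau>g x * n x $ 3) (at x within I)"
    and n3': "((\<lambda>x. n x $ 3) has_real_derivative \<tau>g x * n x $ 2) (at x within I)" if "x \<in> I" for x
    using has_real_derivative_nth[OF n'[OF that], of 2] has_real_derivative_nth[OF n'[OF that], of 3]
    by (simp_all add: Q that)
  obtain \<theta> where n_cos: "\<And>x. x \<in> I \<Longrightarrow> n x $ 2 = cos (\<theta> x)"
    and n_sin: "\<And>x. x \<in> I \<Longrightarrow> n x $ 3 = sin (\<theta> x)"
    and \<theta>: "\<And>x. x \<in> I \<Longrightarrow> (\<theta> has_real_derivative \<tau>g x) (at x within I)"
    using ex_angle_of_rotating_unit_vector[OF assms(1) n2' n3' normal(2)] by metis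
  \<comment> \<open>The shift negates both sine and cosine, which absorbs the sign of the last
    component of \<open>T'\<close>, and leaves the derivative \<open>\<tau>g\<close>
    unchanged.\<close>
  define \<theta>' where "\<theta>' x = \<theta> x + pi" for x
  have A: "acceleration I \<gamma> x = \<kappa>g x *\<^sub>R darboux_Q I \<gamma> n x + \<kappa>n x *\<^sub>R n x" if "x \<in> I" for x
    using vector_derivative_within[OF nontriv[OF that] T'[OF that]] by (simp add: acceleration_def)
  have A_nth: "acceleration I \<gamma> x $ 1 = 0" "acceleration I \<gamma> x $ 2 = N1 \<kappa>g \<kappa>n \<theta> x"
    "acceleration I \<gamma> x $ 3 = N2 \<kappa>g \<kappa>n \<theta>' x" if "x \<in> I" for x
    using that by (simp_all add: A Q normal n_cos n_sin N1_def N2_def \<theta>'_def)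
  have \<kappa>: "curvature I \<gamma> x = sqrt ((\<kappa>g x)\<^sup>2 + (\<kappa>n x)\<^sup>2)" if "x \<in> I" for x
  proof -
    \<comment> \<open>The two-square identity; the squares on the left are those of
      \<open>N1\<close> at \<open>\<theta>\<close> and \<open>N2\<close> at
      \<open>\<theta>'\<close>.\<close>
    have "(\<kappa>g x * s + \<kappa>n x * c)\<^sup>2 + (\<kappa>n x * s - \<kappa>g x * c)\<^sup>2
        = ((\<kappa>g x)\<^sup>2 + (\<kappa>n x)\<^sup>2) * (s\<^sup>2 + c\<^sup>2)" for s c
      by algebra
    from this[of "sin (\<theta> x)" "cos (\<theta> x)"] show ?thesis
      using that by (simp add: curvature_def gal_norm_isotropic A_nth N1_def N2_def \<theta>'_def)
  qed
  have "indefinite_integral I \<tau>g \<theta>" "indefinite_integral I \<tau>g \<theta>'"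
    using \<theta> DERIV_add[OF \<theta> DERIV_const]
    by (auto simp: indefinite_integral_def \<theta>'_def[abs_def])
  moreover have "indefinite_integral I (N1 \<kappa>g \<kappa>n \<theta>) (\<lambda>x. tangent I \<gamma> x $ 2)"
    "indefinite_integral I (N2 \<kappa>g \<kappa>n \<theta>') (\<lambda>x. tangent I \<gamma> x $ 3)"
    unfolding indefinite_integral_def
    \<comment> \<open>Reading \<open>A\<close> backwards turns the Darboux expression for
      \<open>T'\<close> into the acceleration, whose components are already known.\<close>
    using has_real_derivative_nth[OF T', of _ 2] has_real_derivative_nth[OF T', of _ 3]
    by (simp_all add: A[symmetric] A_nth)
  ultimately show ?thesis
    using smarandache_components[OF T1 A_nth(1)] A_nth(2,3) \<kappa>
    by (intro exI[of _ \<theta>] exI[of _ \<theta>'] exI[of _ "\<lambda>x. tangent I \<gamma> x $ 2"]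
        exI[of _ "\<lambda>x. tangent I \<gamma> x $ 3"]) simp
qed

end
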